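(* (Baire category theorem) Let $E$ be a real Banach space, let $P\subseteq E$ be a normal cone with $\operatorname{int}P\neq\varnothing$, and let $(X,\|\cdot\|_p)$ be a cone Banach space (with respect to $E$ and $P$). Then every countable intersection of dense and open subsets of $X$ is dense in $X$ (with respect to the cone topology $\tau_c$ of $X$).
   Context: Let $E$ be a real Banach space with norm $\|\cdot\|$. A subset $P\subseteq E$ is a cone if (1) $P$ is closed, non-empty and $P\neq\{0\}$; (2) $ax+by\in P$ for all $x,y\in P$ and real $a,b\ge 0$; (3) $P\cap(-P)=\{0\}$. Write $x\le y$ iff $y-x\in P$, and $x\ll y$ iff $y-x\in\operatorname{int}P$, where $\operatorname{int}P$ is the interior of $P$ in $E$. The cone $P$ is normal if there is a number $M>0$ such that for all $x,y\in E$, $0\le x\le y$ implies $\|x\|\le M\|y\|$. A cone normed space $(X,\|\cdot\|_p)$ is a real vector space $X$ with a map $\|\cdot\|_p:X\to E$ such that (1) $\|x\|_p\ge 0$ for all $x\in X$, and $\|x\|_p=0$ iff $x=0$; (2) $\|\alpha x\|_p=|\alpha|\,\|x\|_p$ for all $x\in X$, $\alpha\in\mathbb{R}$; (3) $\|x+y\|_p\le\|x\|_p+\|y\|_p$ for all $x,y\in X$. A sequence $\{x_n\}$ in $X$ converges to $x\in X$ if for every $c\in E$ with $0\ll c$ there is a positive integer $N$ such that $\|x_n-x\|_p\ll c$ for all $n\ge N$. It is Cauchy if for every $c\in E$ with $0\ll c$ there is a positive integer $N$ such that $\|x_n-x_m\|_p\ll c$ for all $n,m\ge N$. $(X,\|\cdot\|_p)$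 is a cone Banach space if every Cauchy sequence in $X$ converges to a point of $X$. For $x\in X$ and $0\ll c$ put $B_c(x)=\{y\in X:\|x-y\|_p\ll c\}$. A subset $B\subseteq X$ is open if for each $b\in B$ there is $p\in E$ with $0\ll p$ and $B_p(b)\subseteq B$. The resulting topology on $X$ is the cone topology $\tau_c$; density is meant with respect to $\tau_c$. *)

theory Defs
  imports "HOL-Analysis.Analysis"
begin

definition is_cone :: "'e::banach set \<Rightarrow> bool" where
  "is_cone P \<longleftrightarrow>
     (closed P \<and> P \<noteq> {} \<and> P \<noteq> {0}) \<and>
     (\<forall>x\<in>P. \<forall>y\<in>P. \<forall>a\<ge>0. \<forall>b\<ge>0. a *\<^sub>R x + b *\<^sub>R y \<in> P) \<and>
     P \<inter> uminus ` P = {0}"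

definition cone_le :: "'e::banach set \<Rightarrow> 'e \<Rightarrow> 'e \<Rightarrow> bool" where
  "cone_le P x y \<longleftrightarrow> y - x \<in> P"

definition cone_ll :: "'e::banach set \<Rightarrow> 'e \<Rightarrow> 'e \<Rightarrow> bool" where
  "cone_ll P x y \<longleftrightarrow> y - x \<in> interior P"

definition normal_cone :: "'e::banach set \<Rightarrow> bool" where
  "normal_cone P \<longleftrightarrow> is_cone P \<and>
     (\<exists>M>0. \<forall>x y. cone_le P 0 x \<and> cone_le P x y \<longrightarrow> norm x \<le> M * norm y)"

text \<open>The vector space \<open>X\<close> is the whole type \<open>'x\<close>; the cone norm is a parameter.\<close>

definition cone_normed_space :: "'e::banach set \<Rightarrow> ('x::real_vector \<Rightarrow> 'e) \<Rightarrow> bool" where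
  "cone_normed_space P nrm \<longleftrightarrow> is_cone P \<and>
     (\<forall>x. cone_le P 0 (nrm x) \<and> (nrm x = 0 \<longleftrightarrow> x = 0)) \<and>
     (\<forall>x \<alpha>. nrm (\<alpha> *\<^sub>R x) = \<bar>\<alpha>\<bar> *\<^sub>R nrm x) \<and>
     (\<forall>x y. cone_le P (nrm (x + y)) (nrm x + nrm y))"

definition cone_converges ::
    "'e::banach set \<Rightarrow> ('x::real_vector \<Rightarrow> 'e) \<Rightarrow> (nat \<Rightarrow> 'x) \<Rightarrow> 'x \<Rightarrow> bool" where
  "cone_converges P nrm s x \<longleftrightarrow>
     (\<forall>c. cone_ll P 0 c \<longrightarrow> (\<exists>N>0. \<forall>n\<ge>N. cone_ll P (nrm (s n - x)) c))"

definition cone_Cauchy ::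
    "'e::banach set \<Rightarrow> ('x::real_vector \<Rightarrow> 'e) \<Rightarrow> (nat \<Rightarrow> 'x) \<Rightarrow> bool" where
  "cone_Cauchy P nrm s \<longleftrightarrow>
     (\<forall>c. cone_ll P 0 c \<longrightarrow> (\<exists>N>0. \<forall>n\<ge>N. \<forall>m\<ge>N. cone_ll P (nrm (s n - s m)) c))"

definition cone_Banach_space :: "'e::banach set \<Rightarrow> ('x::real_vector \<Rightarrow> 'e) \<Rightarrow> bool" where
  "cone_Banach_space P nrm \<longleftrightarrow> cone_normed_space P nrm \<and>
     (\<forall>s. cone_Cauchy P nrm s \<longrightarrow> (\<exists>x. cone_converges P nrm s x))"

definition cone_ball ::
    "'e::banach set \<Rightarrow> ('x::real_vector \<Rightarrow> 'e) \<Rightarrow> 'x \<Rightarrow> 'e \<Rightarrow> 'x set" where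
  "cone_ball P nrm x c = {y. cone_ll P (nrm (x - y)) c}"

definition cone_open :: "'e::banach set \<Rightarrow> ('x::real_vector \<Rightarrow> 'e) \<Rightarrow> 'x set \<Rightarrow> bool" where
  "cone_open P nrm B \<longleftrightarrow> (\<forall>b\<in>B. \<exists>p. cone_ll P 0 p \<and> cone_ball P nrm b p \<subseteq> B)"

definition cone_topology :: "'e::banach set \<Rightarrow> ('x::real_vector \<Rightarrow> 'e) \<Rightarrow> 'x topology" where
  "cone_topology P nrm = topology (cone_open P nrm)"

text \<open>The constructor \<open>topology\<close> is only meaningful on families satisfying \<open>istopology\<close>, which
  holds here as soon as \<open>P\<close> is a cone. If its interior is nonempty, the underlying set is all of
  the type.\<close>

lemma cone_add_interior:
  assumes "is_cone P" "x \<in> P" "y \<in> interior P"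
  shows "x + y \<in> interior P"
proof -
  have add: "u + v \<in> P" if "u \<in> P" "v \<in> P" for u v
  proof -
    have "1 *\<^sub>R u + 1 *\<^sub>R v \<in> P"
      using assms(1) that zero_le_one[where 'a=real] unfolding is_cone_def by metis
    thus ?thesis by simp
  qed
  have "open ((+) x ` interior P)" by (rule open_translation) simp
  moreover have "(+) x ` interior P \<subseteq> P"
    using add assms(2) interior_subset by blast
  ultimately show ?thesis
    using assms(3) by (meson image_eqI interior_maximal subsetD)
qed

lemma cone_ll_common:
  assumes "is_cone P" "cone_ll P 0 p" "cone_ll P 0 q"
  shows "\<exists>r. cone_ll P 0 r \<and> p - r \<in> P \<and> q - r \<in> P"
proof -
  have p: "p \<in> interior P" and q: "q \<in> interior P"
    using assms by (auto simp: cone_ll_def)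
  obtain e where e: "e > 0" "ball q e \<subseteq> P"
    using q by (meson mem_interior)
  define t where "t = min (1/2) (e / (2 * (norm p + 1)))"
  have np: "norm p + 1 > 0" by (simp add: add_nonneg_pos)
  have t: "t > 0" "t < 1" using e np by (auto simp: t_def)
  have sc: "a *\<^sub>R u \<in> P" if "u \<in> P" "a \<ge> 0" for a u
  proof -
    have "a *\<^sub>R u + 0 *\<^sub>R u \<in> P"
      using assms(1) that order_refl[of "0::real"] unfolding is_cone_def by metis
    thus ?thesis by simp
  qed
  have "t * norm p \<le> e / (2 * (norm p + 1)) * norm p"
    by (intro mult_right_mono) (auto simp: t_def)
  also have "\<dots> = e * (norm p / (2 * (norm p + 1)))" by simp
  also have "\<dots> < e * 1"
    using e np by (intro mult_strict_left_mono) (auto simp: divide_simps)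
  finally have "t * norm p < e" by simp
  hence "dist q (q - t *\<^sub>R p) < e" using t by (simp add: dist_norm)
  hence 1: "q - t *\<^sub>R p \<in> P" using e by (auto simp: subset_iff)
  have "p - t *\<^sub>R p = (1 - t) *\<^sub>R p" by (simp add: algebra_simps)
  hence 2: "p - t *\<^sub>R p \<in> P" using sc[of p "1 - t"] p t interior_subset by auto
  have "open ((\<lambda>u. t *\<^sub>R u) ` interior P)" using t by (intro open_scaling) auto
  moreover have "(\<lambda>u. t *\<^sub>R u) ` interior P \<subseteq> P"
    using sc t interior_subset[of P] by auto
  ultimately have "t *\<^sub>R p \<in> interior P"
    using p by (meson image_eqI interior_maximal subsetD)
  thus ?thesis using 1 2 by (auto simp: cone_ll_def)
qed

lemma istopology_cone_open:
  assumes "is_cone P"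
  shows "istopology (cone_open P nrm)"
  unfolding istopology_def
proof (intro conjI allI impI)
  fix S T assume S: "cone_open P nrm S" and T: "cone_open P nrm T"
  show "cone_open P nrm (S \<inter> T)"
    unfolding cone_open_def
  proof
    fix b assume b: "b \<in> S \<inter> T"
    obtain p where p: "cone_ll P 0 p" "cone_ball P nrm b p \<subseteq> S"
      using S b unfolding cone_open_def by (metis IntD1)
    obtain q where q: "cone_ll P 0 q" "cone_ball P nrm b q \<subseteq> T"
      using T b unfolding cone_open_def by (metis IntD2)
    obtain r where r: "cone_ll P 0 r" "p - r \<in> P" "q - r \<in> P"
      using cone_ll_common[OF assms p(1) q(1)] by auto
    have "cone_ball P nrm b r \<subseteq> cone_ball P nrm b s" if "s - r \<in> P" for s
    proof
      fix y assume "y \<in> cone_ball P nrm b r"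
      hence "r - nrm (b - y) \<in> interior P" by (simp add: cone_ball_def cone_ll_def)
      from cone_add_interior[OF assms that this]
      show "y \<in> cone_ball P nrm b s" by (simp add: cone_ball_def cone_ll_def)
    qed
    hence "cone_ball P nrm b r \<subseteq> S \<inter> T"
      using p(2) q(2) r(2,3) by (meson Int_greatest order_trans)
    with r(1) show "\<exists>p. cone_ll P 0 p \<and> cone_ball P nrm b p \<subseteq> S \<inter> T" by (intro exI conjI)
  qed
next
  fix K assume "\<forall>S\<in>K. cone_open P nrm S"
  thus "cone_open P nrm (\<Union>K)" unfolding cone_open_def by (metis Union_iff Union_upper order_trans)
qed

lemma openin_cone_topology:
  "is_cone P \<Longrightarrow> openin (cone_topology P nrm) B \<longleftrightarrow> cone_open P nrm B"
  unfolding cone_topology_def by (simp only: topology_inverse'[OF istopology_cone_open])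

lemma topspace_cone_topology:
  assumes "is_cone P" "interior P \<noteq> {}"
  shows "topspace (cone_topology P nrm) = UNIV"
proof -
  have "cone_open P nrm UNIV"
    using assms(2) by (auto simp: cone_open_def cone_ll_def)
  thus ?thesis
    using openin_subset[of "cone_topology P nrm" UNIV] openin_cone_topology[OF assms(1)] by blast
qed

definition cone_dense :: "'e::banach set \<Rightarrow> ('x::real_vector \<Rightarrow> 'e) \<Rightarrow> 'x set \<Rightarrow> bool" where
  "cone_dense P nrm A \<longleftrightarrow> cone_topology P nrm closure_of A = topspace (cone_topology P nrm)"

end

(*
  Fix e in the interior of P. The gauge of v is the least t >= 0 with v <= t e, and the gauge of
  the cone norm of x - y is a metric on X. Its open ball of radius r about x is exactly the cone
  ball with radius r e, and every c >> 0 dominates r e for some r > 0. Hence the metric induces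
  the cone topology and has the same Cauchy sequences and limits, so the claim is Baire's theorem
  for complete metric spaces.
*)
theory Submission
  imports Defs
begin

section \<open>Interior points of cones\<close>

text \<open>A ball about \<open>c\<close> inside \<open>S\<close> leaves room to move a little in
  any direction; here the direction is \<open>- v\<close>.\<close>

lemma interior_absorbing:
  fixes c v :: "'a::real_normed_vector"
  assumes "c \<in> interior S"
  obtains r where "r > 0" "c - r *\<^sub>R v \<in> S"
proof -
  obtain \<epsilon> where \<epsilon>: "\<epsilon> > 0" "ball c \<epsilon> \<subseteq> S"
    using assms by (meson mem_interior)
  have pos: "norm v + 1 > 0" by (simp add: add_nonneg_pos)
  \<comment> \<open>The summand 1 keeps the denominator positive when \<open>v = 0\<close> and makes
    \<open>r * norm v\<close> strictly less than \<epsilon>.\<close>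
  define r where "r = \<epsilon> / (norm v + 1)"
  have r: "r > 0" using \<epsilon> pos by (simp add: r_def)
  moreover have "r * norm v < \<epsilon>"
    using \<epsilon> pos by (simp add: r_def divide_simps)
  hence "c - r *\<^sub>R v \<in> ball c \<epsilon>"
    using r by (simp add: dist_norm)
  ultimately show ?thesis using \<epsilon> that by blast
qed

lemma is_cone_zero: "is_cone P \<Longrightarrow> 0 \<in> P"
  unfolding is_cone_def by blast

lemma is_cone_add:
  assumes "is_cone P" "u \<in> P" "v \<in> P"
  shows "u + v \<in> P"
proof -
  have "1 *\<^sub>R u + 1 *\<^sub>R v \<in> P"
    using assms zero_le_one[where 'a=real] unfolding is_cone_def by metis
  thus ?thesis by simp
qed

lemma is_cone_scaleR:
  assumes "is_cone P" "u \<in> P" "a \<ge> 0"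
  shows "a *\<^sub>R u \<in> P"
proof -
  have "a *\<^sub>R u + 0 *\<^sub>R u \<in> P"
    using assms order_refl[of "0::real"] unfolding is_cone_def by metis
  thus ?thesis by simp
qed

text \<open>Scaling by a positive factor is an open map that preserves \<open>P\<close>, so it takes
  the interior to an open subset of \<open>P\<close>.\<close>

lemma is_cone_scaleR_interior:
  assumes "is_cone P" "u \<in> interior P" "a > 0"
  shows "a *\<^sub>R u \<in> interior P"
proof -
  have "open ((*\<^sub>R) a ` interior P)" using assms by (intro open_scaling) auto
  moreover have "(*\<^sub>R) a ` interior P \<subseteq> P"
    using is_cone_scaleR[OF assms(1)] assms(3) interior_subset[of P] by auto
  ultimately show ?thesis using assms(2) by (meson image_eqI interior_maximal subsetD)
qed

lemma is_cone_antisym: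
  assumes "is_cone P" "u \<in> P" "- u \<in> P"
  shows "u = 0"
proof -
  have "u \<in> P \<inter> uminus ` P" using assms(2,3) by (auto intro: image_eqI[of _ _ "- u"])
  thus ?thesis using assms(1) unfolding is_cone_def by simp
qed

section \<open>The gauge of an interior point\<close>

text \<open>For \<open>e\<close> in the interior of the cone \<open>P\<close> this is the Minkowski
  functional of \<open>e - P\<close>; on \<open>P\<close> it agrees with the order unit norm of
  \<open>e\<close>. The condition \<open>0 \<le> t\<close> bounds the set below for every
  \<open>v\<close>.\<close>

definition cone_gauge :: "'e::banach set \<Rightarrow> 'e \<Rightarrow> 'e \<Rightarrow> real" where
  "cone_gauge P e v = Inf {t. 0 \<le> t \<and> t *\<^sub>R e - v \<in> P}"

lemma cone_gauge_le: "0 \<le> t \<Longrightarrow> t *\<^sub>R e - v \<in> P \<Longrightarrow> cone_gauge P e v \<le> t"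
  unfolding cone_gauge_def by (rule cInf_lower) (auto intro: bdd_belowI[of _ 0])

locale solid_cone =
  fixes P :: "'e::banach set" and e :: 'e
  assumes cone: "is_cone P" and unit_interior: "e \<in> interior P"
begin

lemma unit_mem: "e \<in> P"
  using unit_interior interior_subset by blast

text \<open>The admissible \<open>t\<close> form a closed set because \<open>P\<close> is closed,
  and a nonempty one because \<open>e\<close> is interior. Hence the infimum is a minimum, which
  spares the later proofs any approximation.\<close>

lemma gauge_attained: "0 \<le> cone_gauge P e v \<and> cone_gauge P e v *\<^sub>R e - v \<in> P"
proof -
  let ?T = "{t. 0 \<le> t \<and> t *\<^sub>R e - v \<in> P}"
  obtain r where r: "r > 0" "e - r *\<^sub>R v \<in> P"
    using interior_absorbing[OF unit_interior] .
  have "(1 / r) *\<^sub>R (e - r *\<^sub>R v) \<in> P"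
    using r by (intro is_cone_scaleR[OF cone]) auto
  hence "1 / r \<in> ?T" using r by (simp add: algebra_simps)
  hence "?T \<noteq> {}" by blast
  moreover have "closed P" using cone by (simp add: is_cone_def)
  hence "closed ((\<lambda>t. t *\<^sub>R e - v) -` P)"
    by (intro closed_vimage continuous_intros)
  hence "closed ({0..} \<inter> (\<lambda>t. t *\<^sub>R e - v) -` P)" by (intro closed_Int) auto
  hence "closed ?T" by (simp add: vimage_def Int_def)
  moreover have "bdd_below ?T" by (auto intro: bdd_belowI[of _ 0])
  ultimately have "Inf ?T \<in> ?T" by (intro closed_contains_Inf)
  thus ?thesis by (simp add: cone_gauge_def)
qed

lemma gauge_nonneg: "0 \<le> cone_gauge P e v"
  using gauge_attained by blast

lemma gauge_bound: "cone_gauge P e v *\<^sub>R e - v \<in> P"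
  using gauge_attained by blast

text \<open>If the minimum is 0, then \<open>v\<close> lies in both \<open>P\<close> and
  \<open>- P\<close>.\<close>

lemma gauge_eq_0_iff:
  assumes "v \<in> P"
  shows "cone_gauge P e v = 0 \<longleftrightarrow> v = 0"
proof
  assume "cone_gauge P e v = 0"
  hence "- v \<in> P" using gauge_bound[of v] by simp
  thus "v = 0" using assms is_cone_antisym[OF cone] by blast
next
  assume "v = 0"
  hence "cone_gauge P e v \<le> 0"
    using is_cone_zero[OF cone] by (intro cone_gauge_le) auto
  thus "cone_gauge P e v = 0" using gauge_nonneg[of v] by simp
qed

text \<open>Add the attained bounds for \<open>u\<close> and \<open>v\<close> to the assumed one for
  \<open>w\<close>. Monotonicity and subadditivity are combined so that the triangle inequality of a
  cone norm fits directly.\<close>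

lemma gauge_triangle:
  assumes "cone_le P w (u + v)"
  shows "cone_gauge P e w \<le> cone_gauge P e u + cone_gauge P e v"
proof (rule cone_gauge_le)
  have "(cone_gauge P e u *\<^sub>R e - u) + (cone_gauge P e v *\<^sub>R e - v) + (u + v - w) \<in> P"
    using assms by (intro is_cone_add[OF cone] gauge_bound) (simp add: cone_le_def)
  thus "(cone_gauge P e u + cone_gauge P e v) *\<^sub>R e - w \<in> P"
    by (simp add: algebra_simps)
qed (simp add: gauge_nonneg)

text \<open>Forwards, the slack below \<open>r\<close> contributes a positive multiple of
  \<open>e\<close>, which is interior. Backwards, an interior point stays in \<open>P\<close> after
  a small multiple of \<open>e\<close> is subtracted, so a bound below \<open>r\<close> is
  admissible.\<close>

lemma gauge_less_iff:
  assumes "0 < r"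
  shows "cone_gauge P e v < r \<longleftrightarrow> cone_ll P v (r *\<^sub>R e)"
proof
  assume less: "cone_gauge P e v < r"
  have "(cone_gauge P e v *\<^sub>R e - v) + (r - cone_gauge P e v) *\<^sub>R e \<in> interior P"
    using less gauge_bound unit_interior
    by (intro cone_add_interior[OF cone] is_cone_scaleR_interior[OF cone]) auto
  thus "cone_ll P v (r *\<^sub>R e)" by (simp add: cone_ll_def algebra_simps)
next
  assume "cone_ll P v (r *\<^sub>R e)"
  hence "r *\<^sub>R e - v \<in> interior P" by (simp add: cone_ll_def)
  then obtain \<epsilon> where \<epsilon>: "\<epsilon> > 0" "r *\<^sub>R e - v - \<epsilon> *\<^sub>R e \<in> P"
    using interior_absorbing by blast
  \<comment> \<open>The cap at \<open>r\<close> keeps \<open>r - \<delta>\<close> nonnegative, as an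
    admissible bound must be.\<close>
  define \<delta> where "\<delta> = min \<epsilon> r"
  have "(r *\<^sub>R e - v - \<epsilon> *\<^sub>R e) + (\<epsilon> - \<delta>) *\<^sub>R e \<in> P"
    using \<epsilon> unit_mem by (intro is_cone_add[OF cone] is_cone_scaleR[OF cone]) (auto simp: \<delta>_def)
  hence "(r - \<delta>) *\<^sub>R e - v \<in> P" by (simp add: algebra_simps)
  hence "cone_gauge P e v \<le> r - \<delta>" by (intro cone_gauge_le) (auto simp: \<delta>_def)
  thus "cone_gauge P e v < r" using assms \<epsilon> by (simp add: \<delta>_def)
qed

lemma ll_scaleR_unit: "r > 0 \<Longrightarrow> cone_ll P 0 (r *\<^sub>R e)"
  using is_cone_scaleR_interior[OF cone unit_interior] by (simp add: cone_ll_def)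

text \<open>Absorption gives \<open>r *\<^sub>R e\<close> below \<open>c\<close>, and a gauge less
  than \<open>r\<close> puts \<open>v\<close> strictly below \<open>r *\<^sub>R e\<close>. One
  \<open>r\<close> serves all \<open>v\<close>.\<close>

lemma ll_if_gauge_less:
  assumes "cone_ll P 0 c"
  obtains r where "r > 0" "\<And>v. cone_gauge P e v < r \<Longrightarrow> cone_ll P v c"
proof -
  obtain r where r: "r > 0" "c - r *\<^sub>R e \<in> P"
    using assms interior_absorbing[of c P e] by (auto simp: cone_ll_def)
  have "cone_ll P v c" if "cone_gauge P e v < r" for v
  proof -
    have "r *\<^sub>R e - v \<in> interior P"
      using that gauge_less_iff[OF r(1)] by (simp add: cone_ll_def)
    from cone_add_interior[OF cone r(2) this] show ?thesis
      by (simp add: cone_ll_def)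
  qed
  with r(1) that show ?thesis by blast
qed

end

section \<open>The metric and its topology\<close>

locale solid_cone_normed_space = solid_cone P e
  for P :: "'e::banach set" and e :: 'e +
  fixes nrm :: "'x::real_vector \<Rightarrow> 'e"
  assumes normed: "cone_normed_space P nrm"
begin

lemma nrm_mem: "nrm x \<in> P"
  using normed by (simp add: cone_normed_space_def cone_le_def)

lemma nrm_eq_0_iff: "nrm x = 0 \<longleftrightarrow> x = 0"
  using normed by (simp add: cone_normed_space_def)

lemma nrm_minus_commute: "nrm (x - y) = nrm (y - x)"
proof -
  have "nrm ((-1) *\<^sub>R (y - x)) = \<bar>-1\<bar> *\<^sub>R nrm (y - x)"
    using normed unfolding cone_normed_space_def by blast
  thus ?thesis by simp
qed

lemma nrm_triangle: "cone_le P (nrm (x - z)) (nrm (x - y) + nrm (y - z))"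
proof -
  have "cone_le P (nrm ((x - y) + (y - z))) (nrm (x - y) + nrm (y - z))"
    using normed unfolding cone_normed_space_def by blast
  thus ?thesis by simp
qed

definition gdist :: "'x \<Rightarrow> 'x \<Rightarrow> real" where
  "gdist x y = cone_gauge P e (nrm (x - y))"

sublocale G: Metric_space UNIV gdist
proof
  show "0 \<le> gdist x y" for x y
    by (simp add: gdist_def gauge_nonneg)
  show "gdist x y = gdist y x" for x y
    by (simp add: gdist_def nrm_minus_commute)
  show "gdist x y = 0 \<longleftrightarrow> x = y" for x y
    by (simp add: gdist_def gauge_eq_0_iff nrm_mem nrm_eq_0_iff)
  show "gdist x z \<le> gdist x y + gdist y z" for x y z
    unfolding gdist_def by (rule gauge_triangle) (rule nrm_triangle)
qed

lemma mball_eq_cone_ball: "r > 0 \<Longrightarrow> G.mball x r = cone_ball P nrm x (r *\<^sub>R e)"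
  by (auto simp: cone_ball_def gdist_def gauge_less_iff)

lemma mball_subset_cone_ball:
  assumes "cone_ll P 0 c"
  obtains r where "r > 0" "G.mball x r \<subseteq> cone_ball P nrm x c"
proof -
  obtain r where "r > 0" "\<And>v. cone_gauge P e v < r \<Longrightarrow> cone_ll P v c"
    using ll_if_gauge_less[OF assms] by blast
  moreover from this have "G.mball x r \<subseteq> cone_ball P nrm x c"
    by (auto simp: cone_ball_def gdist_def)
  ultimately show ?thesis using that by blast
qed

text \<open>Every cone ball contains a concentric metric ball, and every metric ball of positive
  radius is itself a cone ball.\<close>

lemma cone_open_iff_openin_mtopology: "cone_open P nrm U \<longleftrightarrow> openin G.mtopology U"
proof
  assume U: "cone_open P nrm U"
  have "\<exists>r>0. G.mball x r \<subseteq> U" if x: "x \<in> U" for x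
  proof -
    obtain c where c: "cone_ll P 0 c" "cone_ball P nrm x c \<subseteq> U"
      using U x unfolding cone_open_def by meson
    obtain r where "r > 0" "G.mball x r \<subseteq> cone_ball P nrm x c"
      using mball_subset_cone_ball[OF c(1)] .
    thus ?thesis using c(2) by (meson order_trans)
  qed
  thus "openin G.mtopology U" by (simp add: G.openin_mtopology)
next
  assume U: "openin G.mtopology U"
  have "\<exists>c. cone_ll P 0 c \<and> cone_ball P nrm x c \<subseteq> U" if x: "x \<in> U" for x
  proof -
    obtain r where r: "r > 0" "G.mball x r \<subseteq> U"
      using U x unfolding G.openin_mtopology by meson
    show ?thesis
    proof (intro exI conjI)
      show "cone_ll P 0 (r *\<^sub>R e)" using r(1) by (rule ll_scaleR_unit)
      show "cone_ball P nrm x (r *\<^sub>R e) \<subseteq> U"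
        using r(2) unfolding mball_eq_cone_ball[OF r(1)] .
    qed
  qed
  thus "cone_open P nrm U" by (simp add: cone_open_def)
qed

lemma cone_topology_eq_mtopology: "cone_topology P nrm = G.mtopology"
  by (simp add: topology_eq openin_cone_topology[OF cone] cone_open_iff_openin_mtopology)

section \<open>Completeness and the Baire property\<close>

lemma cone_Cauchy_if_MCauchy:
  assumes "G.MCauchy s"
  shows "cone_Cauchy P nrm s"
  unfolding cone_Cauchy_def
proof (intro allI impI)
  fix c assume "cone_ll P 0 c"
  then obtain r where r: "r > 0" "\<And>v. cone_gauge P e v < r \<Longrightarrow> cone_ll P v c"
    using ll_if_gauge_less by blast
  obtain N where "\<And>n m. N \<le> n \<Longrightarrow> N \<le> m \<Longrightarrow> gdist (s n) (s m) < r"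
    using assms r(1) unfolding G.MCauchy_def by meson
  thus "\<exists>N>0. \<forall>n\<ge>N. \<forall>m\<ge>N. cone_ll P (nrm (s n - s m)) c"
    \<comment> \<open>\<open>Suc N\<close> replaces \<open>N\<close> because the index in
      \<open>cone_Cauchy\<close> must be positive.\<close>
    using r(2) by (intro exI[of _ "Suc N"]) (simp add: gdist_def)
qed

text \<open>It suffices to test cone convergence on the multiples \<open>r *\<^sub>R e\<close>, for
  which the cone condition is exactly \<open>gdist (s n) x < r\<close>.\<close>

lemma limitin_if_cone_converges:
  assumes "cone_converges P nrm s x"
  shows "limitin G.mtopology s x sequentially"
  unfolding G.limit_metric_sequentially
proof (intro conjI allI impI)
  fix r :: real assume r: "r > 0"
  then obtain N where "\<And>n. n \<ge> N \<Longrightarrow> cone_ll P (nrm (s n - x)) (r *\<^sub>R e)"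
    using assms ll_scaleR_unit unfolding cone_converges_def by meson
  thus "\<exists>N. \<forall>n\<ge>N. s n \<in> UNIV \<and> gdist (s n) x < r"
    using gauge_less_iff[OF r] by (auto simp: gdist_def)
qed simp

text \<open>A metric Cauchy sequence is cone Cauchy, so it has a cone limit, which is also its
  metric limit.\<close>

lemma mcomplete_if_cone_Banach_space: "cone_Banach_space P nrm \<Longrightarrow> G.mcomplete"
  unfolding G.mcomplete_def cone_Banach_space_def
  using cone_Cauchy_if_MCauchy limitin_if_cone_converges by blast

end

theorem theorem2p7:
  fixes P :: "'e::banach set"
    and nrm :: "'x::real_vector \<Rightarrow> 'e"
    and \<U> :: "'x set set"
  assumes "normal_cone P"
    and "interior P \<noteq> {}"
    and "cone_Banach_space P nrm"
    and "countable \<U>"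
    and "\<And>U. U \<in> \<U> \<Longrightarrow> openin (cone_topology P nrm) U \<and> cone_dense P nrm U"
  shows "cone_dense P nrm (\<Inter>\<U>)"
proof -
  \<comment> \<open>Any interior point will do: its choice affects the metric but not the
    topology.\<close>
  obtain e where e: "e \<in> interior P" using assms(2) by blast
  interpret solid_cone_normed_space P e nrm
    using assms(1,3) e by unfold_locales (auto simp: normal_cone_def cone_Banach_space_def)
  show ?thesis
    using G.metric_Baire_category[OF mcomplete_if_cone_Banach_space[OF assms(3)] assms(4)] assms(5)
    by (simp add: cone_dense_def cone_topology_eq_mtopology)
qed

end
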